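(* Let $A$ be an additive abelian group and let $\varphi\in\operatorname{Aut}A$. Suppose that $Q=\operatorname{Alex}(A,\varphi)$ is involutory and connected, and let $T:=\{t\in A\mid 2t=0\}$ be the subgroup of $A$ whose elements are involutions. Then for all functions $\rho:A\to A$, $\rho$ is a good involution of $Q$ if and only if there exists an element $t\in T$ such that $\rho(a)=t+a$ for all $a\in A$. In particular, $|\operatorname{Good}Q|=|T|$.
   Context: A quandle is a pair $(X,s)$ where $X$ is a set and $s:X\to S_X$, $x\mapsto s_x$, is a function to the symmetric group $S_X$ such that $s_xs_y=s_{s_x(y)}s_x$ and $s_x(x)=x$ for all $x,y\in X$. A quandle is involutory (a kei) if $s_x^2=\mathrm{id}_X$ for all $x\in X$. The inner automorphism group $\operatorname{Inn}(X,s)$ is the subgroup of $S_X$ generated by $\{s_x\mid x\in X\}$; the quandle is connected if $\operatorname{Inn}(X,s)$ acts transitively on $X$. For an additive abelian group $A$ and $\varphi\in\operatorname{Aut}A$, the Alexander quandle $\operatorname{Alex}(A,\varphi)$ has underlying set $A$ and $s_a(b):=\varphi(b-a)+a$ for all $a,b\in A$. A good involution of a quandle $(X,s)$ is a permutation $\rho\in S_X$ with $\rho^2=\mathrm{id}_X$ (the identity map is allowed) such that $\rho s_x=s_x\rho$ and $s_{\rho(x)}=s_x^{-1}$ for all $x\in X$. $\operatorname{Good}Q$ denotes the set of all good involutions of $Q$. *)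

theory Defs
  imports "HOL-Algebra.Group_Action" "HOL-Algebra.Generated_Groups" "HOL-Algebra.Ring"
    "HOL-Library.Equipollence"
begin

text \<open>
  Self-maps of a set \<open>X\<close> are represented extensionally, as in \<^const>\<open>BijGroup\<close>, whose carrier plays
  the role of the symmetric group on \<open>X\<close>; its product \<open>f \<otimes> g\<close> is the composition
  \<open>x \<mapsto> f (g x)\<close>.
\<close>

definition quandle :: "'a set \<Rightarrow> ('a \<Rightarrow> 'a \<Rightarrow> 'a) \<Rightarrow> bool" where
  "quandle X s \<longleftrightarrow>
     (\<forall>x\<in>X. s x \<in> carrier (BijGroup X)) \<and>
     (\<forall>x\<in>X. \<forall>y\<in>X. s x \<otimes>\<^bsub>BijGroup X\<^esub> s y = s (s x y) \<otimes>\<^bsub>BijGroup X\<^esub> s x) \<and>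
     (\<forall>x\<in>X. s x x = x)"

definition involutory :: "'a set \<Rightarrow> ('a \<Rightarrow> 'a \<Rightarrow> 'a) \<Rightarrow> bool" where
  "involutory X s \<longleftrightarrow> (\<forall>x\<in>X. s x \<otimes>\<^bsub>BijGroup X\<^esub> s x = \<one>\<^bsub>BijGroup X\<^esub>)"

definition Inn :: "'a set \<Rightarrow> ('a \<Rightarrow> 'a \<Rightarrow> 'a) \<Rightarrow> ('a \<Rightarrow> 'a) set" where
  "Inn X s = generate (BijGroup X) (s ` X)"

definition quandle_connected :: "'a set \<Rightarrow> ('a \<Rightarrow> 'a \<Rightarrow> 'a) \<Rightarrow> bool" where
  "quandle_connected X s \<longleftrightarrow>
     transitive_action (BijGroup X \<lparr>carrier := Inn X s\<rparr>) X (\<lambda>g. g)"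

definition good_involution :: "'a set \<Rightarrow> ('a \<Rightarrow> 'a \<Rightarrow> 'a) \<Rightarrow> ('a \<Rightarrow> 'a) \<Rightarrow> bool" where
  "good_involution X s \<rho> \<longleftrightarrow>
     \<rho> \<in> carrier (BijGroup X) \<and>
     \<rho> \<otimes>\<^bsub>BijGroup X\<^esub> \<rho> = \<one>\<^bsub>BijGroup X\<^esub> \<and>
     (\<forall>x\<in>X. \<rho> \<otimes>\<^bsub>BijGroup X\<^esub> s x = s x \<otimes>\<^bsub>BijGroup X\<^esub> \<rho> \<and>
            s (\<rho> x) = inv\<^bsub>BijGroup X\<^esub> s x)"

definition Good :: "'a set \<Rightarrow> ('a \<Rightarrow> 'a \<Rightarrow> 'a) \<Rightarrow> ('a \<Rightarrow> 'a) set" where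
  "Good X s = {\<rho>. good_involution X s \<rho>}"

text \<open>
  An additive abelian group is the additive part of a ring record satisfying
  \<^locale>\<open>abelian_group\<close>; the multiplicative fields of the record are irrelevant. The underlying set
  of the Alexander quandle is \<open>carrier A\<close>.
\<close>

definition alexander ::
    "('a, 'm) ring_scheme \<Rightarrow> ('a \<Rightarrow> 'a) \<Rightarrow> 'a \<Rightarrow> 'a \<Rightarrow> 'a" where
  "alexander A \<phi> = (\<lambda>a \<in> carrier A. \<lambda>b \<in> carrier A. \<phi> (b \<ominus>\<^bsub>A\<^esub> a) \<oplus>\<^bsub>A\<^esub> a)"

definition two_torsion :: "('a, 'm) ring_scheme \<Rightarrow> 'a set" where
  "two_torsion A = {t \<in> carrier A. add_pow A (2::nat) t = \<zero>\<^bsub>A\<^esub>}"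

lemma quandle_connected_iff:
  assumes "quandle X s"
  shows "quandle_connected X s \<longleftrightarrow> (\<forall>x\<in>X. \<forall>y\<in>X. \<exists>g\<in>Inn X s. g x = y)"
proof -
  interpret B: group "BijGroup X" by (rule group_BijGroup)
  have sub: "s ` X \<subseteq> carrier (BijGroup X)"
    using assms by (auto simp: quandle_def)
  have sg: "subgroup (Inn X s) (BijGroup X)"
    unfolding Inn_def by (rule B.generate_is_subgroup[OF sub])
  have "group_hom (BijGroup X \<lparr>carrier := Inn X s\<rparr>) (BijGroup X) (\<lambda>g. g)"
    using subgroup.subset[OF sg]
    by (auto intro!: group_hom.intro group_hom_axioms.intro B.subgroup_imp_group[OF sg]
        B.is_group simp: hom_def)
  then show ?thesis
    by (auto simp: quandle_connected_def transitive_action_def transitive_action_axioms_def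
        group_action_def)
qed

lemma quandle_alexander:
  assumes "abelian_group A" and "\<phi> \<in> auto (add_monoid A)"
  shows "quandle (carrier A) (alexander A \<phi>)"
proof -
  interpret A: abelian_group A by fact
  have bij: "bij_betw \<phi> (carrier A) (carrier A)"
    using assms(2) by (auto simp: auto_def Bij_def)
  have cl[simp]: "\<phi> x \<in> carrier A" if "x \<in> carrier A" for x
    using bij that by (auto simp: bij_betw_def)
  have add: "\<phi> (x \<oplus>\<^bsub>A\<^esub> y) = \<phi> x \<oplus>\<^bsub>A\<^esub> \<phi> y" if "x \<in> carrier A" "y \<in> carrier A" for x y
    using assms(2) that by (auto simp: auto_def hom_def)
  have zero: "\<phi> \<zero>\<^bsub>A\<^esub> = \<zero>\<^bsub>A\<^esub>"
    using add[of "\<zero>\<^bsub>A\<^esub>" "\<zero>\<^bsub>A\<^esub>"] by (metis A.add.r_cancel_one cl A.zero_closed A.l_zero)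
  have neg: "\<phi> (\<ominus>\<^bsub>A\<^esub> x) = \<ominus>\<^bsub>A\<^esub> \<phi> x" if "x \<in> carrier A" for x
    using add[of "\<ominus>\<^bsub>A\<^esub> x" x] that zero
    by (metis A.a_inv_closed A.l_neg A.minus_equality cl)
  have s_eq: "alexander A \<phi> a b = \<phi> b \<ominus>\<^bsub>A\<^esub> \<phi> a \<oplus>\<^bsub>A\<^esub> a"
    if "a \<in> carrier A" "b \<in> carrier A" for a b
    using that by (simp add: alexander_def A.minus_eq add neg)
  have s_Bij: "alexander A \<phi> a \<in> Bij (carrier A)" if a: "a \<in> carrier A" for a
  proof -
    have 1: "bij_betw (\<lambda>b. b \<ominus>\<^bsub>A\<^esub> a) (carrier A) (carrier A)"
      by (rule bij_betw_byWitness[where f' = "\<lambda>b. b \<oplus>\<^bsub>A\<^esub> a"])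
        (use a in \<open>auto simp: A.minus_eq A.a_assoc A.l_neg A.r_neg\<close>)
    have 2: "bij_betw (\<lambda>b. b \<oplus>\<^bsub>A\<^esub> a) (carrier A) (carrier A)"
      by (rule bij_betw_byWitness[where f' = "\<lambda>b. b \<ominus>\<^bsub>A\<^esub> a"])
        (use a in \<open>auto simp: A.minus_eq A.a_assoc A.l_neg A.r_neg\<close>)
    have "bij_betw ((\<lambda>b. b \<oplus>\<^bsub>A\<^esub> a) \<circ> \<phi> \<circ> (\<lambda>b. b \<ominus>\<^bsub>A\<^esub> a)) (carrier A) (carrier A)"
      by (intro bij_betw_trans[OF _ 2] bij_betw_trans[OF 1] bij)
    then have "bij_betw (alexander A \<phi> a) (carrier A) (carrier A)"
      by (rule bij_betw_cong[THEN iffD1, rotated]) (use a in \<open>auto simp: alexander_def\<close>)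
    then show ?thesis
      using a by (auto simp: Bij_def alexander_def)
  qed
  have s_cl: "alexander A \<phi> a b \<in> carrier A" if "a \<in> carrier A" "b \<in> carrier A" for a b
    using that by (simp add: s_eq)
  have dist: "alexander A \<phi> a (alexander A \<phi> b c)
      = alexander A \<phi> (alexander A \<phi> a b) (alexander A \<phi> a c)"
    if a: "a \<in> carrier A" and b: "b \<in> carrier A" and c: "c \<in> carrier A" for a b c
  proof -
    define u where "u = \<ominus>\<^bsub>A\<^esub> \<phi> a \<oplus>\<^bsub>A\<^esub> a"
    have u: "u \<in> carrier A" using a by (simp add: u_def)
    have sa: "alexander A \<phi> a x = \<phi> x \<oplus>\<^bsub>A\<^esub> u" if "x \<in> carrier A" for x
      using a that by (simp add: s_eq u_def A.minus_eq A.a_assoc)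
    have cancel: "(p \<oplus>\<^bsub>A\<^esub> u) \<ominus>\<^bsub>A\<^esub> (q \<oplus>\<^bsub>A\<^esub> u) = p \<ominus>\<^bsub>A\<^esub> q"
      if "p \<in> carrier A" "q \<in> carrier A" for p q
    proof -
      have "(p \<oplus>\<^bsub>A\<^esub> u) \<ominus>\<^bsub>A\<^esub> (q \<oplus>\<^bsub>A\<^esub> u) = p \<oplus>\<^bsub>A\<^esub> (u \<oplus>\<^bsub>A\<^esub> (\<ominus>\<^bsub>A\<^esub> u \<oplus>\<^bsub>A\<^esub> \<ominus>\<^bsub>A\<^esub> q))"
        using that u by (simp add: A.minus_eq A.minus_add A.a_ac del: A.r_neg1 A.r_neg2)
      then show ?thesis using that u by (simp add: A.r_neg2 A.minus_eq)
    qed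
    have s: "alexander A \<phi> x y = \<phi> (y \<ominus>\<^bsub>A\<^esub> x) \<oplus>\<^bsub>A\<^esub> x" if "x \<in> carrier A" "y \<in> carrier A" for x y
      using that by (simp add: alexander_def)
    have "alexander A \<phi> (alexander A \<phi> a b) (alexander A \<phi> a c)
        = \<phi> (\<phi> c \<ominus>\<^bsub>A\<^esub> \<phi> b) \<oplus>\<^bsub>A\<^esub> (\<phi> b \<oplus>\<^bsub>A\<^esub> u)"
      using a b c u by (simp only: sa[OF b] sa[OF c] s cancel cl A.a_closed)
    also have "\<dots> = \<phi> (\<phi> (c \<ominus>\<^bsub>A\<^esub> b) \<oplus>\<^bsub>A\<^esub> b) \<oplus>\<^bsub>A\<^esub> u"
      using b c u by (simp add: A.minus_eq add neg A.a_assoc)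
    also have "\<dots> = alexander A \<phi> a (alexander A \<phi> b c)"
      using a b c by (simp add: s[of b c] sa)
    finally show ?thesis by simp
  qed
  have comp: "alexander A \<phi> a \<otimes>\<^bsub>BijGroup (carrier A)\<^esub> alexander A \<phi> b
      = alexander A \<phi> (alexander A \<phi> a b) \<otimes>\<^bsub>BijGroup (carrier A)\<^esub> alexander A \<phi> a"
    if "a \<in> carrier A" "b \<in> carrier A" for a b
  proof -
    have "compose (carrier A) (alexander A \<phi> a) (alexander A \<phi> b)
        = compose (carrier A) (alexander A \<phi> (alexander A \<phi> a b)) (alexander A \<phi> a)"
      unfolding compose_def by (rule restrict_ext) (rule dist[OF that])
    then show ?thesis
      using that s_Bij s_cl by (simp add: BijGroup_def)
  qed
  have idem: "alexander A \<phi> a a = a" if "a \<in> carrier A" for a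
    using that by (simp add: s_eq A.minus_eq A.r_neg)
  have "carrier (BijGroup (carrier A)) = Bij (carrier A)"
    by (simp add: BijGroup_def)
  then show ?thesis
    unfolding quandle_def using s_Bij comp idem by blast
qed

end

theory Submission
  imports Defs
begin

text \<open>
  The two hypotheses on the Alexander quandle determine \<open>\<phi>\<close> completely. Since
  \<open>s\<^sub>0 = \<phi>\<close>, involutivity says \<open>\<phi>\<^sup>2 = 1\<close>. Since \<open>s\<^sub>a(b) = \<phi>(b) + (a - \<phi>(a))\<close>, the
  subgroup \<open>(1 - \<phi>)A\<close> is stable under every symmetry, so it contains the whole orbit of \<open>0\<close>,
  and connectedness forces \<open>A = (1 - \<phi>)A\<close>. On elements \<open>x - \<phi>(x)\<close> an involution
  \<open>\<phi>\<close> acts as \<open>-1\<close>; therefore \<open>\<phi> = -1\<close>, the symmetries are the point reflections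
  \<open>s\<^sub>a(b) = 2a - b\<close>, and \<open>A = 2A\<close>
  (\<open>alexander_connected_surj\<close>, \<open>alexander_connected_involutory_negation\<close>).

  Now write a good involution as \<open>\<rho>(a) = \<tau>(a) + a\<close>. The condition \<open>s (\<rho> a) = s a\<close> says
  \<open>2\<rho>(a) = 2a\<close>, that is \<open>\<tau>(a) \<in> T\<close>. Commutation with \<open>s\<^sub>x\<close>, applied at \<open>0\<close>, gives
  \<open>\<rho>(2x) = 2x - \<rho>(0) = 2x + \<rho>(0)\<close>. Because every element of \<open>A\<close> is some \<open>2x\<close>, \<open>\<rho>\<close> is
  the translation by \<open>\<rho>(0) \<in> T\<close>. Conversely, a translation by \<open>t \<in> T\<close> commutes with point
  reflections because \<open>t = -t\<close>, and moving the centre of a reflection by \<open>t\<close> changes the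
  reflection by \<open>2t = 0\<close>. Evaluation at \<open>0\<close> recovers \<open>t\<close>, which gives the
  equality of cardinalities.
\<close>

section \<open>Involutory quandles\<close>

lemma involutory_apply:
  assumes "quandle X s" "involutory X s" "x \<in> X" "y \<in> X"
  shows "s x (s x y) = y"
proof -
  have "s x \<in> Bij X"
    using assms(1,3) by (auto simp: quandle_def BijGroup_def)
  moreover have "s x \<otimes>\<^bsub>BijGroup X\<^esub> s x = \<one>\<^bsub>BijGroup X\<^esub>"
    using assms(2,3) by (auto simp: involutory_def)
  ultimately have "compose X (s x) (s x) = (\<lambda>x\<in>X. x)"
    by (simp add: BijGroup_def)
  from fun_cong[OF this, of y] show ?thesis
    using assms(4) by (simp add: compose_def)
qed

lemma involutory_inverse:
  assumes "quandle X s" "involutory X s" "x \<in> X"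
  shows "inv\<^bsub>BijGroup X\<^esub> s x = s x"
proof -
  interpret B: group "BijGroup X" by (rule group_BijGroup)
  have "s x \<in> carrier (BijGroup X)"
    using assms(1,3) unfolding quandle_def by blast
  moreover have "s x \<otimes>\<^bsub>BijGroup X\<^esub> s x = \<one>\<^bsub>BijGroup X\<^esub>"
    using assms(2,3) unfolding involutory_def by blast
  ultimately show ?thesis by (intro B.inv_equality)
qed

text \<open>
  Involutivity makes the generating set \<open>s ` X\<close> closed under inverses, so stability under the
  symmetries themselves is enough.
\<close>

lemma Inn_preserves:
  assumes quandle: "quandle X s" and involutory: "involutory X s"
    and "I \<subseteq> X" and stable: "\<And>x y. x \<in> X \<Longrightarrow> y \<in> I \<Longrightarrow> s x y \<in> I"
    and "g \<in> Inn X s" and "y \<in> I"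
  shows "g y \<in> I"
proof -
  interpret B: group "BijGroup X" by (rule group_BijGroup)
  have sub: "s ` X \<subseteq> carrier (BijGroup X)"
    using quandle by (auto simp: quandle_def)
  have "\<forall>y\<in>I. g y \<in> I"
    using \<open>g \<in> Inn X s\<close> unfolding Inn_def
  proof (induction rule: generate.induct)
    case one
    then show ?case using \<open>I \<subseteq> X\<close> by (auto simp: BijGroup_def)
  next
    case (incl h)
    then show ?case using stable by auto
  next
    case (inv h)
    then obtain x where x: "x \<in> X" "h = s x" by blast
    then show ?case
      unfolding x(2) involutory_inverse[OF quandle involutory x(1)] using stable by blast
  next
    case (eng h1 h2)
    have carrier: "carrier (BijGroup X) = Bij X"
      by (simp add: BijGroup_def)
    have "h1 \<in> Bij X" "h2 \<in> Bij X"
      using B.generate_in_carrier[OF sub] eng.hyps unfolding carrier by blast+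
    then have "(h1 \<otimes>\<^bsub>BijGroup X\<^esub> h2) y = h1 (h2 y)" if "y \<in> I" for y
      using that \<open>I \<subseteq> X\<close> by (auto simp: BijGroup_def compose_def)
    then show ?case using eng.IH by simp
  qed
  then show ?thesis using \<open>y \<in> I\<close> by blast
qed

text \<open>
  A self-map with \<open>\<rho>\<^sup>2 = 1\<close> is automatically a permutation, and in an involutory quandle
  \<open>s\<^sub>x\<close> is its own inverse; so all the conditions on \<open>\<rho>\<close> become pointwise identities.
\<close>

lemma good_involution_iff:
  assumes quandle: "quandle X s" and involutory: "involutory X s"
    and \<rho>: "\<rho> \<in> X \<rightarrow>\<^sub>E X"
  shows "good_involution X s \<rho> \<longleftrightarrow>
    (\<forall>x\<in>X. \<rho> (\<rho> x) = x) \<and> (\<forall>x\<in>X. \<forall>y\<in>X. \<rho> (s x y) = s x (\<rho> y)) \<and> (\<forall>x\<in>X. s (\<rho> x) = s x)"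
    (is "_ \<longleftrightarrow> ?sq \<and> ?comm \<and> ?sym")
proof -
  have sB: "s x \<in> Bij X" if "x \<in> X" for x
    using quandle that by (auto simp: quandle_def BijGroup_def)
  have compose_eq_iff: "compose X f g = compose X f' g' \<longleftrightarrow> (\<forall>y\<in>X. f (g y) = f' (g' y))"
    for f g f' g' :: "'a \<Rightarrow> 'a"
    unfolding compose_def fun_eq_iff by auto
  have sq: "compose X \<rho> \<rho> = (\<lambda>x\<in>X. x) \<longleftrightarrow> ?sq"
    unfolding compose_def fun_eq_iff by auto
  have \<rho>B: "\<rho> \<in> Bij X" if ?sq
  proof -
    have "bij_betw \<rho> X X"
      by (rule bij_betw_byWitness[where f' = \<rho>]) (use that \<rho> in auto)
    then show ?thesis using \<rho> by (auto simp: Bij_def PiE_def)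
  qed
  have mult: "f \<otimes>\<^bsub>BijGroup X\<^esub> g = compose X f g" if "f \<in> Bij X" "g \<in> Bij X" for f g
    using that by (simp add: BijGroup_def)
  have carrier: "carrier (BijGroup X) = Bij X" and one: "\<one>\<^bsub>BijGroup X\<^esub> = (\<lambda>x\<in>X. x)"
    by (simp_all add: BijGroup_def)
  have comm: "\<rho> \<otimes>\<^bsub>BijGroup X\<^esub> s x = s x \<otimes>\<^bsub>BijGroup X\<^esub> \<rho> \<longleftrightarrow> (\<forall>y\<in>X. \<rho> (s x y) = s x (\<rho> y))"
    if "\<rho> \<in> Bij X" "x \<in> X" for x
    unfolding mult[OF that(1) sB[OF that(2)]] mult[OF sB[OF that(2)] that(1)] compose_eq_iff ..
  have inv: "s (\<rho> x) = inv\<^bsub>BijGroup X\<^esub> s x \<longleftrightarrow> s (\<rho> x) = s x" if "x \<in> X" for x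
    unfolding involutory_inverse[OF quandle involutory that] ..
  have "good_involution X s \<rho> \<longleftrightarrow> \<rho> \<in> Bij X \<and> ?sq \<and> ?comm \<and> ?sym"
    unfolding good_involution_def carrier one
    using mult[of \<rho> \<rho>] sq comm inv by metis
  then show ?thesis using \<rho>B by blast
qed

section \<open>Involutory connected Alexander quandles\<close>

lemma (in abelian_group) add_auto_simps:
  assumes "\<phi> \<in> auto (add_monoid G)"
  shows "x \<in> carrier G \<Longrightarrow> \<phi> x \<in> carrier G"
    and "x \<in> carrier G \<Longrightarrow> y \<in> carrier G \<Longrightarrow> \<phi> (x \<oplus> y) = \<phi> x \<oplus> \<phi> y"
    and "\<phi> \<zero> = \<zero>"
    and "x \<in> carrier G \<Longrightarrow> \<phi> (\<ominus> x) = \<ominus> \<phi> x"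
proof -
  have hom: "\<phi> \<in> hom (add_monoid G) (add_monoid G)"
    using assms unfolding auto_def by blast
  interpret h: group_hom "add_monoid G" "add_monoid G" \<phi>
    by (intro group_hom.intro group_hom_axioms.intro a_group hom)
  show "x \<in> carrier G \<Longrightarrow> \<phi> x \<in> carrier G"
    by (rule h.hom_closed[simplified])
  show "x \<in> carrier G \<Longrightarrow> y \<in> carrier G \<Longrightarrow> \<phi> (x \<oplus> y) = \<phi> x \<oplus> \<phi> y"
    by (rule h.hom_mult[simplified])
  show "\<phi> \<zero> = \<zero>"
    by (rule h.hom_one[simplified])
  show "x \<in> carrier G \<Longrightarrow> \<phi> (\<ominus> x) = \<ominus> \<phi> x"
    unfolding a_inv_def by (rule h.hom_inv[simplified])
qed

lemma (in abelian_group) alexander_eq: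
  assumes "\<phi> \<in> auto (add_monoid G)" "a \<in> carrier G" "b \<in> carrier G"
  shows "alexander G \<phi> a b = \<phi> b \<oplus> (a \<ominus> \<phi> a)"
  using assms by (simp add: alexander_def minus_eq add_auto_simps[OF assms(1)] a_ac)

text \<open>
  The image of \<open>1 - \<phi>\<close> contains \<open>0\<close> and is stable under all symmetries, so a connected
  quandle leaves no room outside it.
\<close>

lemma (in abelian_group) alexander_connected_surj:
  assumes \<phi>: "\<phi> \<in> auto (add_monoid G)"
    and involutory: "involutory (carrier G) (alexander G \<phi>)"
    and connected: "quandle_connected (carrier G) (alexander G \<phi>)"
    and a: "a \<in> carrier G"
  shows "\<exists>x\<in>carrier G. a = x \<ominus> \<phi> x"
proof -
  note \<phi>_simps = add_auto_simps[OF \<phi>]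
  define I where "I = (\<lambda>x. x \<ominus> \<phi> x) ` carrier G"
  have quandle: "quandle (carrier G) (alexander G \<phi>)"
    by (rule quandle_alexander[OF abelian_group_axioms \<phi>])
  have I: "I \<subseteq> carrier G"
    by (auto simp: I_def \<phi>_simps)
  have zero: "\<zero> \<in> I"
    unfolding I_def by (rule image_eqI[of _ _ \<zero>]) (simp_all add: \<phi>_simps minus_eq minus_equality[of \<zero> \<zero>])
  have stable: "alexander G \<phi> x y \<in> I" if x: "x \<in> carrier G" and "y \<in> I" for x y
  proof -
    obtain z where z: "z \<in> carrier G" "y = z \<ominus> \<phi> z"
      using \<open>y \<in> I\<close> by (auto simp: I_def)
    \<comment> \<open>\<open>\<phi>\<close> commutes with \<open>1 - \<phi>\<close>, so \<open>\<phi> z + x\<close> is a preimage.\<close>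
    have "alexander G \<phi> x y = (\<phi> z \<oplus> x) \<ominus> \<phi> (\<phi> z \<oplus> x)"
      using x z by (simp add: alexander_eq[OF \<phi>] \<phi>_simps minus_eq minus_add a_ac)
    then show ?thesis
      unfolding I_def by (rule image_eqI) (use x z in \<open>simp add: \<phi>_simps\<close>)
  qed
  obtain g where "g \<in> Inn (carrier G) (alexander G \<phi>)" "g \<zero> = a"
    using connected a unfolding quandle_connected_iff[OF quandle] by blast
  then have "a \<in> I"
    using Inn_preserves[OF quandle involutory I stable _ zero] by blast
  then show ?thesis by (auto simp: I_def)
qed

text \<open>
  From \<open>\<phi>\<^sup>2 = 1\<close> follows \<open>\<phi>(x - \<phi>(x)) = \<phi>(x) - x\<close>, and by connectedness every element has
  the form \<open>x - \<phi>(x)\<close>.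
\<close>

lemma (in abelian_group) alexander_connected_involutory_negation:
  assumes \<phi>: "\<phi> \<in> auto (add_monoid G)"
    and involutory: "involutory (carrier G) (alexander G \<phi>)"
    and connected: "quandle_connected (carrier G) (alexander G \<phi>)"
    and a: "a \<in> carrier G"
  shows "\<phi> a = \<ominus> a"
proof -
  note \<phi>_simps = add_auto_simps[OF \<phi>]
  have quandle: "quandle (carrier G) (alexander G \<phi>)"
    by (rule quandle_alexander[OF abelian_group_axioms \<phi>])
  have sq: "\<phi> (\<phi> x) = x" if "x \<in> carrier G" for x
    using involutory_apply[OF quandle involutory zero_closed that] that
    by (simp add: alexander_eq[OF \<phi>] \<phi>_simps minus_eq minus_equality[of \<zero> \<zero>])
  obtain x where x: "x \<in> carrier G" "a = x \<ominus> \<phi> x"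
    using alexander_connected_surj[OF \<phi> involutory connected a] by blast
  then show ?thesis
    by (simp add: \<phi>_simps minus_eq minus_add sq a_ac)
qed

section \<open>Good involutions of a quandle of point reflections\<close>

lemma (in abelian_group) two_torsion_iff:
  "t \<in> two_torsion G \<longleftrightarrow> t \<in> carrier G \<and> t \<oplus> t = \<zero>"
proof -
  have "add_pow G (2::nat) t = t \<oplus> t" if "t \<in> carrier G"
    using that by (simp add: numeral_2_eq_2)
  then show ?thesis by (auto simp: two_torsion_def)
qed

text \<open>
  Divisibility of the group by two is what makes the displacement \<open>\<rho>(a) - a\<close> constant:
  commutation with the reflections only compares it at \<open>b\<close> and \<open>2x - b\<close>, and for \<open>b = 0\<close>
  the points \<open>2x\<close> fill the group.
\<close>

lemma (in abelian_group) good_involution_reflections_iff: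
  assumes quandle: "quandle (carrier G) s" and involutory: "involutory (carrier G) s"
    and ext: "\<And>a. a \<in> carrier G \<Longrightarrow> s a \<in> extensional (carrier G)"
    and s: "\<And>a b. a \<in> carrier G \<Longrightarrow> b \<in> carrier G \<Longrightarrow> s a b = a \<oplus> a \<ominus> b"
    and divisible: "\<And>a. a \<in> carrier G \<Longrightarrow> \<exists>x\<in>carrier G. a = x \<oplus> x"
    and \<rho>: "\<rho> \<in> carrier G \<rightarrow>\<^sub>E carrier G"
  shows "good_involution (carrier G) s \<rho> \<longleftrightarrow>
    (\<exists>t\<in>two_torsion G. \<forall>a\<in>carrier G. \<rho> a = t \<oplus> a)"
proof
  have cl: "\<rho> a \<in> carrier G" if "a \<in> carrier G" for a
    using \<rho> that by auto
  assume "good_involution (carrier G) s \<rho>"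
  then have comm: "\<rho> (s x y) = s x (\<rho> y)" and sym: "s (\<rho> x) = s x"
    if "x \<in> carrier G" "y \<in> carrier G" for x y
    using that unfolding good_involution_iff[OF quandle involutory \<rho>] by blast+
  define t where "t = \<rho> \<zero>"
  have t: "t \<in> carrier G" by (simp add: t_def cl)
  have tt: "t \<oplus> t = \<zero>"
    using fun_cong[OF sym[of \<zero> \<zero>], of \<zero>] t by (simp add: s cl minus_eq flip: t_def)
  then have neg: "\<ominus> t = t" using t by (simp add: minus_equality)
  have "\<rho> a = t \<oplus> a" if "a \<in> carrier G" for a
  proof -
    obtain x where x: "x \<in> carrier G" "a = x \<oplus> x"
      using divisible \<open>a \<in> carrier G\<close> by blast
    then show ?thesis
      using comm[of x \<zero>] t neg
      by (simp add: s minus_eq minus_equality[of \<zero> \<zero>] a_ac flip: t_def)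
  qed
  then show "\<exists>t\<in>two_torsion G. \<forall>a\<in>carrier G. \<rho> a = t \<oplus> a"
    using t tt by (auto simp: two_torsion_iff)
next
  assume "\<exists>t\<in>two_torsion G. \<forall>a\<in>carrier G. \<rho> a = t \<oplus> a"
  then obtain t where t: "t \<in> carrier G" and tt: "t \<oplus> t = \<zero>"
    and \<rho>t: "\<And>a. a \<in> carrier G \<Longrightarrow> \<rho> a = t \<oplus> a"
    by (auto simp: two_torsion_iff)
  have neg: "\<ominus> t = t" using t tt by (simp add: minus_equality)
  have cancel: "t \<oplus> (t \<oplus> x) = x" if "x \<in> carrier G" for x
    using t tt that by (simp flip: a_assoc)
  have "\<rho> (s x y) = s x (\<rho> y)" if "x \<in> carrier G" "y \<in> carrier G" for x y
    using that t by (simp add: \<rho>t s minus_eq minus_add neg a_ac)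
  moreover have "s (\<rho> x) = s x" if x: "x \<in> carrier G" for x
  proof (rule extensionalityI[OF ext ext])
    fix y assume "y \<in> carrier G"
    then show "s (\<rho> x) y = s x y"
      using x t by (simp add: \<rho>t s minus_eq a_ac cancel)
  qed (use x t in \<open>simp_all add: \<rho>t\<close>)
  ultimately show "good_involution (carrier G) s \<rho>"
    unfolding good_involution_iff[OF quandle involutory \<rho>]
    using t by (simp add: \<rho>t cancel)
qed

section \<open>Good involutions of connected involutory Alexander quandles\<close>

theorem corollary4p10:
  fixes A :: "('a, 'm) ring_scheme" and \<phi> :: "'a \<Rightarrow> 'a"
  assumes "abelian_group A"
    and "\<phi> \<in> auto (add_monoid A)"
    and "involutory (carrier A) (alexander A \<phi>)"
    and "quandle_connected (carrier A) (alexander A \<phi>)"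
  shows "(\<forall>\<rho> \<in> carrier A \<rightarrow>\<^sub>E carrier A.
            good_involution (carrier A) (alexander A \<phi>) \<rho> \<longleftrightarrow>
            (\<exists>t \<in> two_torsion A. \<forall>a \<in> carrier A. \<rho> a = t \<oplus>\<^bsub>A\<^esub> a))
       \<and> Good (carrier A) (alexander A \<phi>) \<approx> two_torsion A"
proof -
  interpret A: abelian_group A by fact
  note \<phi> = assms(2) and involutory = assms(3) and connected = assms(4)
  note negation = A.alexander_connected_involutory_negation[OF \<phi> involutory connected]
  have quandle: "quandle (carrier A) (alexander A \<phi>)"
    using assms(1,2) by (rule quandle_alexander)
  have reflection: "alexander A \<phi> a b = a \<oplus>\<^bsub>A\<^esub> a \<ominus>\<^bsub>A\<^esub> b"
    if "a \<in> carrier A" "b \<in> carrier A" for a b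
    using that by (simp add: A.alexander_eq[OF \<phi>] negation A.minus_eq A.a_ac)
  have divisible: "\<exists>x\<in>carrier A. a = x \<oplus>\<^bsub>A\<^esub> x" if "a \<in> carrier A" for a
    using A.alexander_connected_surj[OF \<phi> involutory connected that]
    by (auto simp: negation A.minus_eq)
  have iff: "good_involution (carrier A) (alexander A \<phi>) \<rho> \<longleftrightarrow>
      (\<exists>t \<in> two_torsion A. \<forall>a \<in> carrier A. \<rho> a = t \<oplus>\<^bsub>A\<^esub> a)"
    if "\<rho> \<in> carrier A \<rightarrow>\<^sub>E carrier A" for \<rho>
    by (rule A.good_involution_reflections_iff[OF quandle involutory _ reflection divisible that])
      (simp only: alexander_def restrict_apply' restrict_extensional)
  let ?transl = "\<lambda>t. \<lambda>a\<in>carrier A. t \<oplus>\<^bsub>A\<^esub> a"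
  have "Good (carrier A) (alexander A \<phi>) = ?transl ` two_torsion A"
  proof (intro equalityI subsetI)
    fix \<rho> assume "\<rho> \<in> Good (carrier A) (alexander A \<phi>)"
    then have good: "good_involution (carrier A) (alexander A \<phi>) \<rho>"
      by (simp add: Good_def)
    then have "\<rho> \<in> Bij (carrier A)"
      by (simp add: good_involution_def BijGroup_def)
    then have \<rho>: "\<rho> \<in> carrier A \<rightarrow>\<^sub>E carrier A"
      by (auto simp: Bij_def PiE_def bij_betw_def)
    then obtain t where "t \<in> two_torsion A" "\<forall>a\<in>carrier A. \<rho> a = t \<oplus>\<^bsub>A\<^esub> a"
      using good iff by blast
    moreover from this have "\<rho> = ?transl t"
      using \<rho> by (intro extensionalityI[of _ "carrier A"]) (auto simp: PiE_def)
    ultimately show "\<rho> \<in> ?transl ` two_torsion A" by blast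
  next
    fix \<rho> assume "\<rho> \<in> ?transl ` two_torsion A"
    then obtain t where t: "t \<in> two_torsion A" "\<rho> = ?transl t" by blast
    then have "\<rho> \<in> carrier A \<rightarrow>\<^sub>E carrier A"
      by (auto simp: A.two_torsion_iff)
    with t show "\<rho> \<in> Good (carrier A) (alexander A \<phi>)"
      by (auto simp: Good_def iff)
  qed
  moreover have "inj_on ?transl (two_torsion A)"
  proof (rule inj_onI)
    fix t u assume tu: "t \<in> two_torsion A" "u \<in> two_torsion A" and eq: "?transl t = ?transl u"
    from fun_cong[OF eq, of "\<zero>\<^bsub>A\<^esub>"] tu show "t = u"
      by (simp add: A.two_torsion_iff)
  qed
  ultimately have "Good (carrier A) (alexander A \<phi>) \<approx> two_torsion A"
    by (simp add: inj_on_image_eqpoll_self)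
  with iff show ?thesis by blast
qed

end
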